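(* Let $k \geq 2$ and $d \geq 0$ be integers. Let $u$ be a word over $\mathbb{Z}_{\geq 0}$ of length $k - 1$. Let $v$ be a nonempty finite word over $\mathbb{Z}_{\geq 0} \cup \{0'\}$ whose first letter is $0'$ and whose remaining letters are in $\mathbb{Z}_{\geq 0}$. Let $\varphi$ be the morphism on $\mathbb{Z}_{\geq 0} \cup \{0'\}$ given by $\varphi(0') = v\,\varphi(0)$ and $\varphi(n) = u\,(n + d)$ for $n \in \mathbb{Z}_{\geq 0}$. Then the sequence of letters of $\tau(\varphi^\infty(0'))$ is a $k$-regular sequence.
   Context: A morphism $\varphi$ on an alphabet $\Sigma$ is a map $\Sigma \to \Sigma^*$, extended to words by concatenation. If $\varphi(c)$ begins with the letter $c$, $\varphi^\infty(c)$ denotes the infinite fixed point of $\varphi$ beginning with $c$. Here $0'$ is a new letter not in $\mathbb{Z}_{\geq 0}$, and $\tau$ is the coding with $\tau(0') = 0$ and $\tau(n) = n$ for $n \in \mathbb{Z}_{\geq 0}$. Letters of an infinite word are indexed from position $0$. For an integer $k \geq 2$, an integer sequence $s(i)_{i \geq 0}$ is $k$-regular if the $\mathbb{Z}$-module generated by the set $\{ s(k^e i + j)_{i \geq 0} : e \geq 0,\ 0 \leq j \leq k^e - 1 \}$ is finitely generated. *)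

theory Defs
  imports Complex_Main "HOL-Library.Function_Algebras"
begin

text \<open>Infinite words over \<open>'a\<close> are functions \<open>nat \<Rightarrow> 'a\<close>; a morphism is given by its values
  on letters.\<close>

definition morph_ext :: "('a \<Rightarrow> 'b list) \<Rightarrow> 'a list \<Rightarrow> 'b list" where
  "morph_ext \<phi> w = concat (map \<phi> w)"

definition inf_prefix :: "nat \<Rightarrow> (nat \<Rightarrow> 'a) \<Rightarrow> 'a list" where
  "inf_prefix n w = map w [0..<n]"

text \<open>A relation rather than a function, because an erasing morphism may map an infinite word
  to a finite one; the second conjunct says that \<open>\<phi>(w)\<close> is infinite.\<close>

definition inf_image :: "('a \<Rightarrow> 'b list) \<Rightarrow> (nat \<Rightarrow> 'a) \<Rightarrow> (nat \<Rightarrow> 'b) \<Rightarrow> bool" where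
  "inf_image \<phi> w x \<longleftrightarrow>
     (\<forall>n. inf_prefix (length (morph_ext \<phi> (inf_prefix n w))) x = morph_ext \<phi> (inf_prefix n w)) \<and>
     (\<forall>m. \<exists>n. m \<le> length (morph_ext \<phi> (inf_prefix n w)))"

text \<open>The word \<open>\<phi>\<^sup>\<infinity>(c)\<close>. The description is proper as soon as \<open>\<phi>(c) = c x\<close> with \<open>x\<close> nonempty
  and \<open>\<phi>\<close> is nonerasing; see \<open>fixed_point_ex1\<close> below.\<close>

definition fixed_point :: "('a \<Rightarrow> 'a list) \<Rightarrow> 'a \<Rightarrow> nat \<Rightarrow> 'a" where
  "fixed_point \<phi> c = (THE w. w 0 = c \<and> inf_image \<phi> w w)"

lemma length_inf_prefix [simp]: "length (inf_prefix n w) = n"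
  by (simp add: inf_prefix_def)

lemma nth_inf_prefix [simp]: "i < n \<Longrightarrow> inf_prefix n w ! i = w i"
  by (simp add: inf_prefix_def)

lemma take_inf_prefix: "m \<le> n \<Longrightarrow> take m (inf_prefix n w) = inf_prefix m w"
  by (simp add: inf_prefix_def take_map)

lemma morph_ext_append [simp]: "morph_ext \<phi> (xs @ ys) = morph_ext \<phi> xs @ morph_ext \<phi> ys"
  by (simp add: morph_ext_def)

lemma length_morph_ext_ge:
  assumes "\<And>a. \<phi> a \<noteq> []"
  shows "length xs \<le> length (morph_ext \<phi> xs)"
proof (induction xs)
  case (Cons a xs)
  have "1 \<le> length (\<phi> a)" using assms[of a] by (cases "\<phi> a") auto
  with Cons show ?case by (simp add: morph_ext_def)
qed (simp add: morph_ext_def)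

lemma fixed_point_ex1:
  assumes c: "\<phi> c = c # x" and x: "x \<noteq> []" and ne: "\<And>a. \<phi> a \<noteq> []"
  shows "\<exists>!w. w 0 = c \<and> inf_image \<phi> w w"
proof -
  define W where "W n = (morph_ext \<phi> ^^ n) [c]" for n
  define X where "X n = (morph_ext \<phi> ^^ n) x" for n
  have W0: "W 0 = [c]" by (simp add: W_def)
  have WS: "W (Suc n) = morph_ext \<phi> (W n)" for n by (simp add: W_def)
  have Wapp: "W (Suc n) = W n @ X n" for n
  proof (induction n)
    case 0
    show ?case by (simp add: W_def X_def morph_ext_def c)
  next
    case (Suc n)
    have "W (Suc (Suc n)) = morph_ext \<phi> (W n @ X n)" using Suc WS by simp
    also have "\<dots> = W (Suc n) @ X (Suc n)" using WS by (simp add: X_def)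
    finally show ?case .
  qed
  have Xlen: "0 < length (X n)" for n
  proof (induction n)
    case (Suc n)
    then show ?case using length_morph_ext_ge[where \<phi>=\<phi>, OF ne, of "X n"] by (auto simp: X_def simp del: length_greater_0_conv)
  qed (simp add: X_def x)
  have Wlen: "n < length (W n)" for n
  proof (induction n)
    case (Suc n)
    then show ?case using Xlen[of n] Wapp[of n] by (simp del: length_greater_0_conv)
  qed (simp add: W0)
  have Wpre: "\<exists>z. W (n + m) = W n @ z" for n m
    by (induction m) (use Wapp in auto)
  have Wnth: "W n ! i = W m ! i" if "i < length (W n)" "i < length (W m)" for n m i
    using Wpre[of n "m - n"] Wpre[of m "n - m"] that by (cases "n \<le> m") (auto simp: nth_append)
  define w where "w i = W i ! i" for i
  have wW: "inf_prefix (length (W n)) w = W n" for n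
    by (rule nth_equalityI) (auto simp: w_def intro: Wnth Wlen)
  have img: "inf_image \<phi> w w"
    unfolding inf_image_def
  proof (intro conjI allI)
    fix n
    let ?p = "inf_prefix n w"
    have "?p = take n (W n)"
      using take_inf_prefix[of n "length (W n)" w] Wlen[of n] wW[of n] by simp
    then have "W n = ?p @ drop n (W n)" by simp
    then have "W (Suc n) = morph_ext \<phi> ?p @ morph_ext \<phi> (drop n (W n))"
      using WS morph_ext_append by metis
    then show "inf_prefix (length (morph_ext \<phi> ?p)) w = morph_ext \<phi> ?p"
      using take_inf_prefix[of "length (morph_ext \<phi> ?p)" "length (W (Suc n))" w] wW[of "Suc n"]
      by simp
  next
    fix m
    show "\<exists>n. m \<le> length (morph_ext \<phi> (inf_prefix n w))"
      using length_morph_ext_ge[where \<phi>=\<phi>, OF ne, of "inf_prefix m w"] by auto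
  qed
  show ?thesis
  proof (rule ex1I[of _ w])
    show "w 0 = c \<and> inf_image \<phi> w w" using img by (simp add: w_def W0)
  next
    fix y assume y: "y 0 = c \<and> inf_image \<phi> y y"
    have yW: "inf_prefix (length (W n)) y = W n" for n
    proof (induction n)
      case 0
      show ?case using y by (simp add: W0 inf_prefix_def)
    next
      case (Suc n)
      then show ?case using y WS unfolding inf_image_def by metis
    qed
    show "y = w"
    proof
      fix i
      show "y i = w i" using nth_inf_prefix[OF Wlen[of i], of y] yW[of i] by (simp add: w_def)
    qed
  qed
qed

text \<open>The alphabet \<open>\<int>\<^sub>\<ge>\<^sub>0 \<union> {0'}\<close>, with \<open>ZeroPrime\<close> for \<open>0'\<close>.\<close>

datatype letter = ZeroPrime | Num nat

primrec \<tau> :: "letter \<Rightarrow> nat" where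
  "\<tau> ZeroPrime = 0"
| "\<tau> (Num n) = n"

definition int_seq_scale :: "int \<Rightarrow> (nat \<Rightarrow> int) \<Rightarrow> (nat \<Rightarrow> int)" where
  "int_seq_scale c f = (\<lambda>i. c * f i)"

lemma module_int_seq_scale: "module int_seq_scale"
  by unfold_locales (auto simp: int_seq_scale_def plus_fun_def algebra_simps)

definition k_kernel :: "nat \<Rightarrow> (nat \<Rightarrow> int) \<Rightarrow> (nat \<Rightarrow> int) set" where
  "k_kernel k s = {(\<lambda>i. s (k ^ e * i + j)) | e j. j \<le> k ^ e - 1}"

definition k_regular :: "nat \<Rightarrow> (nat \<Rightarrow> int) \<Rightarrow> bool" where
  "k_regular k s \<longleftrightarrow>
     (\<exists>B. finite B \<and> module.span int_seq_scale B = module.span int_seq_scale (k_kernel k s))"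

end

theory Submission imports Defs begin

text \<open>Write \<open>m\<close> for the length of \<open>v\<close>. The letters \<open>s(i)\<close> of the coded fixed point satisfy
  \<open>s(m + ki + r) = u\<^sub>r\<close> for \<open>r < k - 1\<close> and \<open>s(m + ki + k - 1) = s(i) + d\<close>. The module generated by
  the constant sequence, finitely many unit sequences and the shifts \<open>s(n - t)\<close> with \<open>t \<le> m + k - 1\<close>
  is therefore closed under \<open>f \<mapsto> f(kn + j)\<close>, \<open>0 \<le> j < k\<close>: up to finitely many terms, \<open>s(kn + j - t)\<close>
  is constant or of the form \<open>s(n - t') + d\<close>, where \<open>t' \<le> (t + m + k - 1) / k\<close> stays within
  the bound. So this module contains the \<open>k\<close>-kernel of \<open>s\<close>, and submodules of finitely generated
  abelian groups are finitely generated.\<close>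

section \<open>Submodules of finitely generated abelian groups\<close>

text \<open>Euclidean division: take \<open>g\<close> to be the least positive element. The
  remainder of any element modulo \<open>g\<close> stays in \<open>I\<close> and is smaller than
  \<open>g\<close>, hence is 0. For the zero ideal, \<open>g = 0\<close>.\<close>

lemma int_ideal_principal:
  fixes I :: "int set"
  assumes zero: "0 \<in> I"
    and diff: "\<And>a b. a \<in> I \<Longrightarrow> b \<in> I \<Longrightarrow> a - b \<in> I"
    and mult: "\<And>a c. a \<in> I \<Longrightarrow> c * a \<in> I"
  obtains g where "g \<in> I" "\<And>a. a \<in> I \<Longrightarrow> g dvd a"
proof (cases "\<exists>a\<in>I. a \<noteq> 0")
  case False
  with zero that[of 0] show ?thesis by auto
next
  case True
  then obtain a where a: "a \<in> I" "a \<noteq> 0" by auto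
  define P where "P n \<longleftrightarrow> 0 < n \<and> int n \<in> I" for n
  have "\<bar>a\<bar> \<in> I"
    using mult[OF a(1), of "sgn a"] by (simp only: abs_sgn mult.commute)
  with a(2) have "P (nat \<bar>a\<bar>)" by (simp add: P_def)
  then have least: "P (Least P)" by (rule LeastI)
  let ?g = "int (Least P)"
  have "?g dvd b" if "b \<in> I" for b
  proof (rule ccontr)
    assume "\<not> ?g dvd b"
    then have nz: "b mod ?g \<noteq> 0" by (simp add: dvd_eq_mod_eq_0)
    have pos: "0 < ?g" using least by (simp add: P_def)
    have "b mod ?g = b - (b div ?g) * ?g" by (simp add: minus_div_mult_eq_mod)
    then have "b mod ?g \<in> I" using diff mult that least by (simp add: P_def)
    moreover have ge: "0 \<le> b mod ?g" and less: "b mod ?g < ?g" using pos by simp_all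
    ultimately have "P (nat (b mod ?g))" using nz by (simp add: P_def)
    then have "Least P \<le> nat (b mod ?g)" by (rule Least_le)
    with ge less show False by linarith
  qed
  with least that[of ?g] show ?thesis by (simp add: P_def)
qed

text \<open>Induction on the generating set: an element of \<open>S\<close> realising the generator
  of an ideal of coefficients of \<open>a\<close>, together with generators of
  \<open>S \<inter> span A\<close>, generates \<open>S\<close>.\<close>

lemma int_subspace_finitely_generated:
  fixes scale :: "int \<Rightarrow> 'a::ab_group_add \<Rightarrow> 'a"
  assumes "module scale" and "finite A"
    and "module.subspace scale S" and "S \<subseteq> module.span scale A"
  shows "\<exists>B. finite B \<and> module.span scale B = S"
  using assms(2-4)
proof (induction A arbitrary: S rule: finite_induct)
  interpret module scale by fact
  case empty
  then have "S = {0}" using subspace_0 by auto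
  then have "finite {} \<and> span {} = S" by simp
  then show ?case by blast
next
  interpret module scale by fact
  case (insert a A)
  note S = \<open>subspace S\<close>
  \<comment> \<open>The coefficients that \<open>a\<close> can have in elements of \<open>S\<close>,
    modulo \<open>span A\<close>.\<close>
  define I where "I = {c. \<exists>x\<in>S. x - scale c a \<in> span A}"
  have "0 \<in> I" using subspace_0[OF S] by (auto simp: I_def span_zero intro!: bexI[of _ 0])
  moreover have "c - c' \<in> I" if "c \<in> I" "c' \<in> I" for c c'
  proof -
    from that obtain x y where xy: "x \<in> S" "y \<in> S"
      and sp: "x - scale c a \<in> span A" "y - scale c' a \<in> span A" by (auto simp: I_def)
    have "(x - y) - scale (c - c') a \<in> span A"
      using span_diff[OF sp] by (simp add: algebra_simps)
    with subspace_diff[OF S xy] show ?thesis by (auto simp: I_def)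
  qed
  moreover have "b * c \<in> I" if "c \<in> I" for b c
  proof -
    from that obtain x where x: "x \<in> S" and sp: "x - scale c a \<in> span A" by (auto simp: I_def)
    have "scale b x - scale (b * c) a \<in> span A"
      using span_scale[OF sp, of b] by (simp add: algebra_simps)
    with subspace_scale[OF S x, of b] show ?thesis by (auto simp: I_def)
  qed
  ultimately obtain g where g: "g \<in> I" "\<And>c. c \<in> I \<Longrightarrow> g dvd c"
    using int_ideal_principal by metis
  from g(1) obtain x where x: "x \<in> S" and xg: "x - scale g a \<in> span A" by (auto simp: I_def)
  have "subspace (S \<inter> span A)" by (intro subspace_inter S subspace_span)
  then obtain B where B: "finite B" "span B = S \<inter> span A"
    using insert.IH[of "S \<inter> span A"] by auto
  have "span (insert x B) \<subseteq> S"
    using S x B(2) span_superset[of B] by (intro span_minimal) auto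
  moreover have "S \<subseteq> span (insert x B)"
  proof
    fix y assume y: "y \<in> S"
    then have "y \<in> span (insert a A)" using insert.prems by blast
    then obtain c where c: "y - scale c a \<in> span A" by (auto simp: span_insert)
    with y have "c \<in> I" by (auto simp: I_def)
    then obtain b where b: "c = g * b" using g(2) by blast
    \<comment> \<open>Subtracting \<open>b\<close> copies of \<open>x\<close> cancels the multiple
      of \<open>a\<close>, which leaves an element of
      \<open>S \<inter> span A = span B\<close>.\<close>
    have eq: "y - scale b x = (y - scale c a) - scale b (x - scale g a)"
      by (simp add: b algebra_simps)
    have "y - scale b x \<in> span A" unfolding eq by (rule span_diff[OF c span_scale[OF xg]])
    moreover have "y - scale b x \<in> S" using S x y by (simp add: subspace_diff subspace_scale)
    ultimately show "y \<in> span (insert x B)" using B(2) by (auto simp: span_insert)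
  qed
  ultimately have "finite (insert x B) \<and> span (insert x B) = S" using B(1) by blast
  then show ?case by blast
qed

section \<open>Criteria for membership of the kernel in a module\<close>

interpretation int_seq: module int_seq_scale
  by (rule module_int_seq_scale)

lemma k_regularI:
  assumes "finite A" and "k_kernel k s \<subseteq> int_seq.span A"
  shows "k_regular k s"
  unfolding k_regular_def
  using assms int_subspace_finitely_generated[OF module_int_seq_scale assms(1)]
  by (simp add: int_seq.span_minimal)

text \<open>Split off the leading base-\<open>k\<close> digit of \<open>j\<close>: with
  \<open>q = j div k ^ e\<close> and \<open>p = j mod k ^ e\<close>, the section for
  \<open>(Suc e, j)\<close> is the \<open>q\<close>-section of the one for
  \<open>(e, p)\<close>.\<close>

lemma k_kernel_subset:
  assumes k: "k > 0" and s: "s \<in> M"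
    and sec: "\<And>f j. f \<in> M \<Longrightarrow> j < k \<Longrightarrow> (\<lambda>n. f (k * n + j)) \<in> M"
  shows "k_kernel k s \<subseteq> M"
proof -
  have "(\<lambda>n. s (k ^ e * n + j)) \<in> M" if "j < k ^ e" for e j
    using that
  proof (induction e arbitrary: j)
    case 0
    with s show ?case by simp
  next
    case (Suc e)
    have pos: "0 < k ^ e" using k by simp
    have r: "j div k ^ e < k" using Suc.prems pos by (simp add: less_mult_imp_div_less)
    have "(\<lambda>n. s (k ^ e * (k * n + j div k ^ e) + j mod k ^ e)) \<in> M"
      using sec[OF Suc.IH r] pos by simp
    moreover have "k ^ e * (k * n + q) + p = k ^ Suc e * n + (k ^ e * q + p)" for n p q
      by (simp add: algebra_simps)
    ultimately show ?case by simp
  qed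
  moreover have "j < k ^ e" if "j \<le> k ^ e - 1" for e j
    using that zero_less_power[OF k, of e] by linarith
  ultimately show ?thesis by (auto simp: k_kernel_def)
qed

text \<open>The difference \<open>f - g\<close> is supported below \<open>N\<close>, so it is a
  finite combination of unit sequences.\<close>

lemma span_eventually_eq:
  fixes f g :: "nat \<Rightarrow> int"
  assumes unit: "\<And>a. a < N \<Longrightarrow> (\<lambda>n. of_bool (n = a)) \<in> A"
    and g: "g \<in> int_seq.span A" and eq: "\<And>n. n \<ge> N \<Longrightarrow> f n = g n"
  shows "f \<in> int_seq.span A"
proof -
  let ?h = "\<Sum>a<N. int_seq_scale (f a - g a) (\<lambda>n. of_bool (n = a))"
  have sum_apply: "(\<Sum>a\<in>X. F a) n = (\<Sum>a\<in>X. F a n)" for X :: "nat set" and F :: "nat \<Rightarrow> nat \<Rightarrow> int" and n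
    by (induction X rule: infinite_finite_induct) auto
  have "?h n = (if n < N then f n - g n else 0)" for n
    by (simp add: sum_apply int_seq_scale_def of_bool_def if_distrib cong: if_cong)
  then have "f = g + ?h" using eq by (auto simp: fun_eq_iff)
  moreover have "?h \<in> int_seq.span A"
    by (intro int_seq.span_sum int_seq.span_scale int_seq.span_base) (simp add: unit)
  ultimately show ?thesis using g int_seq.span_add by metis
qed

section \<open>Regularity from the block recurrence\<close>

lemma k_regular_if_recurrence:
  fixes s u :: "nat \<Rightarrow> int" and d :: int
  assumes k: "k \<ge> 2"
    and rec_u: "\<And>i r. r < k - 1 \<Longrightarrow> s (m + k * i + r) = u r"
    and rec_s: "\<And>i. s (m + k * i + (k - 1)) = s i + d"
  shows "k_regular k s"
proof -
  \<comment> \<open>Chosen so that \<open>t \<le> T\<close> gives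
    \<open>(t + m + k - 1) div k \<le> 2 * T div k \<le> T\<close>.\<close>
  define T where "T = m + k - 1"
  \<comment> \<open>From \<open>N\<close> on, the subtractions \<open>n - t'\<close> and
    \<open>k * n + j - t\<close> with \<open>t, t' \<le> T\<close> are not truncated, and sections
    of the unit sequences vanish.\<close>
  define N where "N = T + m"
  define unit :: "nat \<Rightarrow> nat \<Rightarrow> int" where "unit a = (\<lambda>n. of_bool (n = a))" for a
  define shift where "shift t = (\<lambda>n. s (n - t))" for t
  define one where "one = (\<lambda>n::nat. 1::int)"
  define A where "A = insert one (unit ` {..<N} \<union> shift ` {..T})"
  have "finite A" by (simp add: A_def)
  have ev: "f \<in> int_seq.span A" if "g \<in> int_seq.span A" "\<And>n. n \<ge> N \<Longrightarrow> f n = g n" for f g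
    by (rule span_eventually_eq[OF _ that]) (auto simp: A_def unit_def)
  have const: "(\<lambda>n. c) \<in> int_seq.span A" for c
    using int_seq.span_scale[OF int_seq.span_base, of one A c]
    by (simp add: A_def one_def int_seq_scale_def)
  have shift: "shift t \<in> int_seq.span A" if "t \<le> T" for t
    using that by (intro int_seq.span_base) (simp add: A_def)
  have gen: "(\<lambda>n. f (k * n + j)) \<in> int_seq.span A" if f: "f \<in> A" and j: "j < k" for f j
  proof -
    consider "f = one" | a where "a < N" "f = unit a" | t where "t \<le> T" "f = shift t"
      using f by (auto simp: A_def)
    then show ?thesis
    proof cases
      case 1
      with const[of 1] show ?thesis by (simp add: one_def)
    next
      case (2 a)
      have "k * n + j \<noteq> a" if "n \<ge> N" for n
      proof -
        have "n \<le> k * n" using k by simp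
        with \<open>a < N\<close> that show ?thesis by linarith
      qed
      then show ?thesis by (intro ev[OF const[of 0]]) (simp add: \<open>f = unit a\<close> unit_def)
    next
      case (3 t)
      \<comment> \<open>Writing \<open>k * n + j - t = m + k * (n - q) + r\<close> with
        \<open>0 \<le> r < k\<close> forces \<open>q\<close> to be the ceiling of
        \<open>(t + m - j) / k\<close>. This is \<open>c div k\<close>, and \<open>r\<close> is the
        matching remainder.\<close>
      define c where "c = t + m + k - 1 - j"
      define r where "r = k - 1 - c mod k"
      have "c \<le> 2 * T" using \<open>t \<le> T\<close> by (simp add: c_def T_def)
      also have "\<dots> \<le> k * T" using k by (rule mult_right_mono) simp
      finally have "c div k \<le> k * T div k" by (rule div_le_mono)
      then have cT: "c div k \<le> T" using k by simp
      have idx: "k * n + j - t = m + k * (n - c div k) + r" if n: "n \<ge> N" for n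
      proof -
        have le: "c div k \<le> n" using cT n by (simp add: N_def)
        have "k * n = k * (n - c div k) + k * (c div k)"
          using le by (metis distrib_left le_add_diff_inverse2)
        moreover have "k * (c div k) + c mod k = c" by simp
        moreover have "c mod k < k" using k by simp
        moreover have "n \<le> k * n" using k by simp
        ultimately show ?thesis
          using n j \<open>t \<le> T\<close> unfolding c_def[symmetric] r_def N_def
          using c_def by linarith
      qed
      show ?thesis
      proof (cases "r < k - 1")
        case True
        then show ?thesis
          by (intro ev[OF const[of "u r"]]) (simp add: \<open>f = shift t\<close> shift_def idx rec_u)
      next
        case False
        then have "r = k - 1" by (simp add: r_def)
        then show ?thesis
          by (intro ev[OF int_seq.span_add[OF shift[OF cT] const[of d]]])
            (simp add: \<open>f = shift t\<close> shift_def idx rec_s[unfolded One_nat_def])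
      qed
    qed
  qed
  have "(\<lambda>n. f (k * n + j)) \<in> int_seq.span A" if f: "f \<in> int_seq.span A" and j: "j < k" for f j
    using f
  proof (induction rule: int_seq.span_induct_alt)
    case base
    show ?case using int_seq.span_zero by (simp add: zero_fun_def)
  next
    case (step c x y)
    have "(\<lambda>n. (int_seq_scale c x + y) (k * n + j)) =
        int_seq_scale c (\<lambda>n. x (k * n + j)) + (\<lambda>n. y (k * n + j))"
      by (simp add: int_seq_scale_def plus_fun_def)
    then show ?case
      using int_seq.span_add[OF int_seq.span_scale[OF gen[OF step(1) j]] step(2)] by simp
  qed
  moreover have "s \<in> int_seq.span A" using shift[of 0] by (simp add: shift_def)
  ultimately have "k_kernel k s \<subseteq> int_seq.span A" using k by (intro k_kernel_subset) auto
  with \<open>finite A\<close> show ?thesis by (rule k_regularI)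
qed

section \<open>Block structure of the fixed point\<close>

text \<open>Only the first letter is \<open>0'\<close>, and its image is \<open>v\<close> followed
  by the image of 0. Hence the fixed point is \<open>v\<close> followed by the images of its own
  coded letters, all of length \<open>Suc (length u)\<close>.\<close>

lemma fixed_point_block:
  fixes \<phi> :: "letter \<Rightarrow> letter list"
  assumes v: "v \<noteq> []" "hd v = ZeroPrime" "set (tl v) \<subseteq> range Num"
    and zero: "\<phi> ZeroPrime = v @ \<phi> (Num 0)"
    and num: "\<And>n. \<phi> (Num n) = map Num (u @ [n + d])"
    and r: "r \<le> length u"
  defines "w \<equiv> fixed_point \<phi> ZeroPrime"
  shows "w (length v + Suc (length u) * i + r) = Num ((u @ [\<tau> (w i) + d]) ! r)"
proof -
  have "\<phi> ZeroPrime = ZeroPrime # (tl v @ \<phi> (Num 0))" using v zero by (cases v) auto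
  moreover have "\<phi> a \<noteq> []" for a using v zero num by (cases a) auto
  ultimately have "\<exists>!w. w 0 = ZeroPrime \<and> inf_image \<phi> w w"
    by (intro fixed_point_ex1) (auto simp: num)
  then have "w 0 = ZeroPrime \<and> inf_image \<phi> w w"
    unfolding w_def fixed_point_def by (rule theI')
  then have w0: "w 0 = ZeroPrime"
    and img: "inf_prefix (length (morph_ext \<phi> (inf_prefix n w))) w = morph_ext \<phi> (inf_prefix n w)" for n
    by (auto simp: inf_image_def)
  \<comment> \<open>This is the image of \<open>Num (\<tau> (w i))\<close>; for \<open>i = 0\<close>
    it is the part of the image of \<open>0'\<close> after \<open>v\<close>.\<close>
  define block where "block i = map Num (u @ [\<tau> (w i) + d])" for i
  define L where "L n = v @ concat (map block [0..<n])" for n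
  have L_Suc: "L (Suc n) = L n @ block n" for n by (simp add: L_def)
  have len: "length (L n) = length v + Suc (length u) * n" for n
    by (induction n) (simp_all add: L_Suc, simp_all add: L_def block_def)
  have tl_L: "set (tl (L n)) \<subseteq> range Num" for n
    using v by (auto simp: L_def block_def)
  \<comment> \<open>The prefix must be nonempty: the empty prefix has empty image, whereas
    \<open>L 0 = v\<close>.\<close>
  have L: "morph_ext \<phi> (inf_prefix (Suc n) w) = L (Suc n)" for n
  proof (induction n)
    case 0
    show ?case by (simp add: inf_prefix_def morph_ext_def w0 L_def block_def zero num)
  next
    case (Suc n)
    \<comment> \<open>The image of the first \<open>Suc n\<close> letters is longer than
      \<open>Suc n\<close>, so it already contains the next letter, and not in first position. That
      letter is therefore a \<open>Num\<close>.\<close>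
    have lt: "Suc n < length (L (Suc n))" using v by (cases v) (simp_all add: len)
    then have "w (Suc n) = L (Suc n) ! Suc n"
      using img[of "Suc n"] Suc nth_inf_prefix by metis
    also have "\<dots> \<in> set (tl (L (Suc n)))"
      using lt by (metis length_tl less_diff_conv nth_mem nth_tl Suc_eq_plus1)
    finally obtain x where "w (Suc n) = Num x" using tl_L by blast
    then have "\<phi> (w (Suc n)) = block (Suc n)" by (simp add: block_def num)
    moreover have "inf_prefix (Suc (Suc n)) w = inf_prefix (Suc n) w @ [w (Suc n)]"
      by (simp add: inf_prefix_def)
    ultimately show ?case using Suc L_Suc[of "Suc n"] by (simp add: morph_ext_def)
  qed
  have lt: "length (L i) + r < length (L (Suc i))" using r by (simp add: len)
  have "w (length (L i) + r) = L (Suc i) ! (length (L i) + r)"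
    using img[of "Suc i"] L[of i] nth_inf_prefix[OF lt] by metis
  also have "\<dots> = block i ! r" by (simp add: L_Suc)
  also have "\<dots> = Num ((u @ [\<tau> (w i) + d]) ! r)" using r by (simp add: block_def del: map_append)
  finally show ?thesis by (simp add: len)
qed

theorem theorem2p8:
  fixes k d :: nat
    and u :: "nat list"
    and v :: "letter list"
    and \<phi> :: "letter \<Rightarrow> letter list"
  assumes "k \<ge> 2"
    and "length u = k - 1"
    and "v \<noteq> []"
    and "hd v = ZeroPrime"
    and "set (tl v) \<subseteq> range Num"
    and "\<phi> ZeroPrime = v @ \<phi> (Num 0)"
    and "\<And>n. \<phi> (Num n) = map Num u @ [Num (n + d)]"
  shows "k_regular k (\<lambda>i. int (\<tau> (fixed_point \<phi> ZeroPrime i)))"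
proof -
  have k: "Suc (length u) = k" using assms by simp
  have block: "fixed_point \<phi> ZeroPrime (length v + k * i + r) =
      Num ((u @ [\<tau> (fixed_point \<phi> ZeroPrime i) + d]) ! r)" if "r \<le> length u" for i r
    using fixed_point_block[of v \<phi> u d r i] assms that by (simp add: k)
  show ?thesis
  proof (rule k_regular_if_recurrence[OF \<open>k \<ge> 2\<close>])
    fix i r assume "r < k - 1"
    then have "r < length u" using k by simp
    then show "int (\<tau> (fixed_point \<phi> ZeroPrime (length v + k * i + r))) = int (u ! r)"
      using block[of r i] by (simp add: nth_append)
  next
    fix i
    show "int (\<tau> (fixed_point \<phi> ZeroPrime (length v + k * i + (k - 1)))) =
        int (\<tau> (fixed_point \<phi> ZeroPrime i)) + int d"
      using block[of "length u" i] by (simp flip: k)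
  qed
qed

end
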